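(* Let $R$ be a commutative ring with identity and let $S$ be a multiplicatively closed subset of $R$. If $R$ is a nonnil-$S$-Noetherian ring, then $R$ is a nonnil-$S$-Laskerian ring.
   Context: $Nil(R)$ denotes the nilradical of $R$ (the set of nilpotent elements). An ideal $I$ of $R$ is nonnil if $I\nsubseteq Nil(R)$. An ideal $I$ of $R$ is $S$-finite if there exist $s\in S$ and a finitely generated ideal $J$ of $R$ with $sI\subseteq J\subseteq I$. $R$ is nonnil-$S$-Noetherian if each nonnil ideal of $R$ is $S$-finite. $rad(Q)$ denotes the radical of an ideal $Q$. A proper ideal $Q$ of $R$ with $Q\cap S=\emptyset$ is $S$-primary if there exists $s\in S$ such that for all $a,b\in R$, if $ab\in Q$ then $sa\in Q$ or $sb\in rad(Q)$. An ideal $I$ of $R$ with $I\cap S=\emptyset$ is $S$-decomposable if it is a finite intersection of $S$-primary ideals of $R$. $R$ is nonnil-$S$-Laskerian if every nonnil ideal of $R$ disjoint from $S$ is $S$-decomposable. *)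

theory Defs
  imports "HOL-Algebra.Algebra"
begin

definition nilradical :: "('a, 'b) ring_scheme \<Rightarrow> 'a set" where
  "nilradical R = {x \<in> carrier R. \<exists>n::nat. 0 < n \<and> x [^]\<^bsub>R\<^esub> n = \<zero>\<^bsub>R\<^esub>}"

definition ideal_radical :: "('a, 'b) ring_scheme \<Rightarrow> 'a set \<Rightarrow> 'a set" where
  "ideal_radical R Q = {x \<in> carrier R. \<exists>n::nat. 0 < n \<and> x [^]\<^bsub>R\<^esub> n \<in> Q}"

definition nonnil_ideal :: "('a, 'b) ring_scheme \<Rightarrow> 'a set \<Rightarrow> bool" where
  "nonnil_ideal R I \<longleftrightarrow> ideal I R \<and> \<not> I \<subseteq> nilradical R"

definition fin_gen_ideal :: "('a, 'b) ring_scheme \<Rightarrow> 'a set \<Rightarrow> bool" where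
  "fin_gen_ideal R J \<longleftrightarrow> (\<exists>A \<subseteq> carrier R. finite A \<and> J = Idl\<^bsub>R\<^esub> A)"

definition S_finite :: "('a, 'b) ring_scheme \<Rightarrow> 'a set \<Rightarrow> 'a set \<Rightarrow> bool" where
  "S_finite R S I \<longleftrightarrow> ideal I R \<and>
     (\<exists>s\<in>S. \<exists>J. fin_gen_ideal R J \<and> s <#\<^bsub>R\<^esub> I \<subseteq> J \<and> J \<subseteq> I)"

definition nonnil_S_Noetherian :: "('a, 'b) ring_scheme \<Rightarrow> 'a set \<Rightarrow> bool" where
  "nonnil_S_Noetherian R S \<longleftrightarrow> (\<forall>I. nonnil_ideal R I \<longrightarrow> S_finite R S I)"

definition S_primary :: "('a, 'b) ring_scheme \<Rightarrow> 'a set \<Rightarrow> 'a set \<Rightarrow> bool" where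
  "S_primary R S Q \<longleftrightarrow> ideal Q R \<and> Q \<noteq> carrier R \<and> Q \<inter> S = {} \<and>
     (\<exists>s\<in>S. \<forall>a\<in>carrier R. \<forall>b\<in>carrier R. a \<otimes>\<^bsub>R\<^esub> b \<in> Q \<longrightarrow>
        s \<otimes>\<^bsub>R\<^esub> a \<in> Q \<or> s \<otimes>\<^bsub>R\<^esub> b \<in> ideal_radical R Q)"

(* The family is required to be nonempty: in HOL the empty intersection is UNIV rather than
   carrier R. An ideal disjoint from a set containing \<one> is proper, so the convention that the
   empty intersection is R would not make any further ideal decomposable. *)
definition S_decomposable :: "('a, 'b) ring_scheme \<Rightarrow> 'a set \<Rightarrow> 'a set \<Rightarrow> bool" where
  "S_decomposable R S I \<longleftrightarrow> ideal I R \<and> I \<inter> S = {} \<and>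
     (\<exists>F. finite F \<and> F \<noteq> {} \<and> (\<forall>Q\<in>F. S_primary R S Q) \<and> I = \<Inter>F)"

definition nonnil_S_Laskerian :: "('a, 'b) ring_scheme \<Rightarrow> 'a set \<Rightarrow> bool" where
  "nonnil_S_Laskerian R S \<longleftrightarrow>
     (\<forall>I. nonnil_ideal R I \<and> I \<inter> S = {} \<longrightarrow> S_decomposable R S I)"

end

(* Call an ideal J saturated if s x in J with s in S forces x in J. The saturated ideals containing
   a fixed nonnil ideal I satisfy the ascending chain condition, and the classical argument then
   writes each proper one of them as a finite intersection of primary ideals disjoint from S.
   For the saturation of I, which by S-finiteness is the colon ideal (I : u) of some u in S, let
   this be the intersection of the ideals Q. Then I is the intersection of the ideals
   Q \<inter> (I + uR), and each of these is S-primary because it lies between uQ and Q. *)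
theory Submission
  imports Defs
begin

text \<open>Closure under negation comes from multiplying by \<ominus> \<one>, absorption on the
  right from commutativity.\<close>

lemma (in cring) cring_idealI:
  assumes "I \<subseteq> carrier R" "\<zero> \<in> I"
    and add: "\<And>x y. x \<in> I \<Longrightarrow> y \<in> I \<Longrightarrow> x \<oplus> y \<in> I"
    and mult: "\<And>r x. r \<in> carrier R \<Longrightarrow> x \<in> I \<Longrightarrow> r \<otimes> x \<in> I"
  shows "ideal I R"
proof (rule idealI)
  show "ring R" by (rule ring_axioms)
  show "subgroup I (add_monoid R)"
  proof (rule subgroup.intro)
    show "inv\<^bsub>add_monoid R\<^esub> x \<in> I" if "x \<in> I" for x
    proof -
      have "\<ominus> x = (\<ominus> \<one>) \<otimes> x"
        using that assms(1) by (simp add: l_minus subset_iff)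
      then show ?thesis using mult[of "\<ominus> \<one>" x] that by (simp add: a_inv_def)
    qed
  qed (use assms in auto)
  show "r \<otimes> x \<in> I" "x \<otimes> r \<in> I" if "x \<in> I" "r \<in> carrier R" for r x
    using mult[OF that(2,1)] m_comm[of x r] that assms(1) by auto
qed

lemma nonnil_ideal_superset:
  "nonnil_ideal R I \<Longrightarrow> ideal J R \<Longrightarrow> I \<subseteq> J \<Longrightarrow> nonnil_ideal R J"
  unfolding nonnil_ideal_def by blast

section \<open>Colon ideals and sums with a principal ideal\<close>

context cring
begin

definition colon_ideal :: "'a set \<Rightarrow> 'a \<Rightarrow> 'a set" where
  "colon_ideal J b = {x \<in> carrier R. b \<otimes> x \<in> J}"

lemma ideal_colon_ideal:
  assumes "ideal J R" "b \<in> carrier R"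
  shows "ideal (colon_ideal J b) R"
proof -
  interpret J: ideal J R by fact
  show ?thesis
  proof (rule cring_idealI)
    show "r \<otimes> x \<in> colon_ideal J b" if "r \<in> carrier R" "x \<in> colon_ideal J b" for r x
      using that assms(2) J.I_l_closed[of "b \<otimes> x" r]
      by (auto simp: colon_ideal_def m_lcomm)
  qed (use assms(2) in \<open>auto simp: colon_ideal_def r_distr\<close>)
qed

lemma colon_ideal_superset: "ideal J R \<Longrightarrow> b \<in> carrier R \<Longrightarrow> J \<subseteq> colon_ideal J b"
  by (auto simp: colon_ideal_def ideal.I_l_closed ideal.Icarr)

lemma mem_add_cgenideal_iff:
  "x \<in> J <+>\<^bsub>R\<^esub> PIdl b \<longleftrightarrow> (\<exists>q\<in>J. \<exists>r\<in>carrier R. x = q \<oplus> r \<otimes> b)"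
  unfolding set_add_def' cgenideal_def by blast

end

section \<open>Saturation with respect to a multiplicative set\<close>

locale cring_mult_set = cring R + S: submonoid S R for R (structure) and S
begin

text \<open>For an ideal J this is the contraction to R of its extension to the localization at S.
  The elementwise form avoids constructing that localization.\<close>

definition saturation :: "'a set \<Rightarrow> 'a set" where
  "saturation J = {x \<in> carrier R. \<exists>s\<in>S. s \<otimes> x \<in> J}"

text \<open>These are the ideals equal to their own \<open>saturation\<close>, that is, the ideals
  contracted from the localization at S.\<close>

definition saturated_ideal :: "'a set \<Rightarrow> bool" where
  "saturated_ideal J \<longleftrightarrow> ideal J R \<and> (\<forall>s\<in>S. \<forall>x\<in>carrier R. s \<otimes> x \<in> J \<longrightarrow> x \<in> J)"

lemma saturated_idealD:
  "saturated_ideal J \<Longrightarrow> s \<in> S \<Longrightarrow> x \<in> carrier R \<Longrightarrow> s \<otimes> x \<in> J \<Longrightarrow> x \<in> J"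
  unfolding saturated_ideal_def by blast

lemma saturated_ideal_saturation:
  assumes "ideal J R"
  shows "saturated_ideal (saturation J)"
proof -
  interpret J: ideal J R by fact
  have "ideal (saturation J) R"
  proof (rule cring_idealI)
    show "x \<oplus> y \<in> saturation J" if xy: "x \<in> saturation J" "y \<in> saturation J" for x y
    proof -
      obtain s t where st: "s \<in> S" "t \<in> S" "s \<otimes> x \<in> J" "t \<otimes> y \<in> J" "x \<in> carrier R" "y \<in> carrier R"
        using xy by (auto simp: saturation_def)
      have "t \<otimes> (s \<otimes> x) \<oplus> s \<otimes> (t \<otimes> y) \<in> J"
        using st J.a_closed J.I_l_closed[of "s \<otimes> x" t] J.I_l_closed[of "t \<otimes> y" s] by simp
      also have "t \<otimes> (s \<otimes> x) \<oplus> s \<otimes> (t \<otimes> y) = (s \<otimes> t) \<otimes> (x \<oplus> y)"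
        using st by (simp add: r_distr m_assoc m_lcomm[of t s x])
      finally show ?thesis
        using st S.m_closed[of s t] by (auto simp: saturation_def)
    qed
    show "r \<otimes> x \<in> saturation J" if rx: "r \<in> carrier R" "x \<in> saturation J" for r x
    proof -
      obtain s where s: "s \<in> S" "s \<otimes> x \<in> J" "x \<in> carrier R"
        using rx(2) by (auto simp: saturation_def)
      then have "s \<otimes> (r \<otimes> x) \<in> J"
        using rx(1) J.I_l_closed[of "s \<otimes> x" r] by (simp add: m_lcomm[of s r x])
      then show ?thesis
        using s rx(1) by (auto simp: saturation_def)
    qed
    have "\<one> \<otimes> \<zero> \<in> J" by simp
    then show "\<zero> \<in> saturation J"
      using S.one_closed unfolding saturation_def by blast
  qed (auto simp: saturation_def)
  moreover have "x \<in> saturation J"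
    if sx: "s \<in> S" "x \<in> carrier R" "s \<otimes> x \<in> saturation J" for s x
  proof -
    obtain t where "t \<in> S" "t \<otimes> (s \<otimes> x) \<in> J"
      using sx by (auto simp: saturation_def)
    then have "(t \<otimes> s) \<otimes> x \<in> J" "t \<otimes> s \<in> S"
      using sx by (auto simp: m_assoc)
    then show ?thesis using sx by (auto simp: saturation_def)
  qed
  ultimately show ?thesis by (auto simp: saturated_ideal_def)
qed

lemma saturation_superset:
  assumes "ideal J R"
  shows "J \<subseteq> saturation J"
  using ideal.Icarr[OF assms] by (auto simp: saturation_def intro!: bexI[of _ \<one>])

lemma saturated_ideal_colon_ideal:
  assumes "saturated_ideal J" "b \<in> carrier R"
  shows "saturated_ideal (colon_ideal J b)"
proof -
  have "x \<in> colon_ideal J b"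
    if "s \<in> S" "x \<in> carrier R" "s \<otimes> x \<in> colon_ideal J b" for s x
  proof -
    have "s \<otimes> (b \<otimes> x) \<in> J"
      using that assms(2) by (simp add: colon_ideal_def m_lcomm[of s b x])
    then show ?thesis
      using that assms by (simp add: saturated_ideal_def colon_ideal_def)
  qed
  then show ?thesis
    using assms ideal_colon_ideal by (simp add: saturated_ideal_def)
qed

text \<open>An element s of S in J is s \<otimes> \<one>, so saturatedness would put \<one> into
  J.\<close>

lemma saturated_ideal_Int_empty:
  assumes "saturated_ideal J" "J \<noteq> carrier R"
  shows "J \<inter> S = {}"
proof (rule ccontr)
  assume "J \<inter> S \<noteq> {}"
  then obtain s where "s \<in> J" "s \<in> S" by blast
  then have "\<one> \<in> J"
    using assms(1) by (auto simp: saturated_ideal_def)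
  then show False
    using assms ideal.one_imp_carrier by (auto simp: saturated_ideal_def)
qed

text \<open>As \<open>Idl A\<close> is the least ideal containing A, the finitely generated ideal
  can be traded for its generators: s carries I into every ideal J above A. Later J is a colon ideal
  or a member of a chain.\<close>

lemma S_finiteE:
  assumes "S_finite R S I"
  obtains s A where "s \<in> S" "finite A" "A \<subseteq> I"
    "\<forall>J. ideal J R \<and> A \<subseteq> J \<longrightarrow> I \<subseteq> colon_ideal J s"
proof -
  obtain s A where sA: "s \<in> S" "A \<subseteq> carrier R" "finite A" "s <#\<^bsub>R\<^esub> I \<subseteq> Idl A" "Idl A \<subseteq> I"
    using assms by (auto simp: S_finite_def fin_gen_ideal_def)
  show thesis
  proof (rule that[of s A])
    show "A \<subseteq> I" using genideal_self[OF sA(2)] sA(5) by blast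
    have I: "I \<subseteq> carrier R"
      using assms ideal.Icarr by (auto simp: S_finite_def)
    show "\<forall>J. ideal J R \<and> A \<subseteq> J \<longrightarrow> I \<subseteq> colon_ideal J s"
    proof (intro allI impI subsetI)
      fix J x assume "ideal J R \<and> A \<subseteq> J" and x: "x \<in> I"
      then have "s <#\<^bsub>R\<^esub> I \<subseteq> J"
        using genideal_minimal[of J A] sA(4) by blast
      then show "x \<in> colon_ideal J s"
        using x I unfolding l_coset_def colon_ideal_def by blast
    qed
  qed (use sA in auto)
qed

text \<open>Each of the finitely many elements of A is carried into I by some element of S, and the
  product t of these multipliers serves all of A. Since s carries the whole saturation into (I : t),
  the single element t \<otimes> s carries it into I.\<close>

lemma saturation_eq_colon_ideal:
  assumes "ideal I R" "S_finite R S (saturation I)"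
  obtains u where "u \<in> S" "saturation I = colon_ideal I u"
proof -
  interpret I: ideal I R by fact
  obtain s A where sA: "s \<in> S" "finite A" "A \<subseteq> saturation I"
    "\<forall>J. ideal J R \<and> A \<subseteq> J \<longrightarrow> saturation I \<subseteq> colon_ideal J s"
    using assms(2) by (rule S_finiteE)
  from sA(2,3) have "\<exists>t\<in>S. A \<subseteq> colon_ideal I t"
  proof (induction A)
    case empty
    then show ?case using S.one_closed by blast
  next
    case (insert a A)
    then obtain t r where tr: "t \<in> S" "A \<subseteq> colon_ideal I t" "r \<in> S" "r \<otimes> a \<in> I" "a \<in> carrier R"
      by (auto simp: saturation_def)
    have "(r \<otimes> t) \<otimes> x \<in> I" if "x \<in> insert a A" for x
    proof (cases "x = a")
      case True
      then show ?thesis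
        using tr I.I_l_closed[of "r \<otimes> a" t] by (simp add: m_ac)
    next
      case False
      then show ?thesis
        using that tr I.I_l_closed[of "t \<otimes> x" r] by (auto simp: colon_ideal_def m_assoc)
    qed
    then have "insert a A \<subseteq> colon_ideal I (r \<otimes> t)"
      using tr by (auto simp: colon_ideal_def)
    then show ?case using tr by blast
  qed
  then obtain t where t: "t \<in> S" "A \<subseteq> colon_ideal I t" by blast
  have "t \<otimes> s \<otimes> x \<in> I" if "x \<in> saturation I" for x
  proof -
    have "s \<otimes> x \<in> colon_ideal I t"
      using sA(4)[rule_format, of "colon_ideal I t"] ideal_colon_ideal[OF assms(1), of t] t that
      by (auto simp: colon_ideal_def)
    then show ?thesis
      using that t sA(1) by (auto simp: colon_ideal_def saturation_def m_assoc)
  qed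
  then have "saturation I = colon_ideal I (t \<otimes> s)"
    using t(1) sA(1) S.m_closed[of t s] by (auto simp: saturation_def colon_ideal_def)
  then show thesis using that t(1) sA(1) by blast
qed

text \<open>Well-foundedness of reversed strict inclusion is the ascending chain condition. The
  union of an infinite ascending chain above I is a nonnil ideal, hence S-finite. Its finite set A
  lies in some \<open>C n\<close>, so s carries the union into \<open>C n\<close>; saturatedness
  cancels s, and the chain cannot grow after n.\<close>

lemma wf_saturated_ideals:
  assumes "nonnil_S_Noetherian R S" "nonnil_ideal R I"
  shows "wf {(K, J). saturated_ideal J \<and> saturated_ideal K \<and> I \<subseteq> J \<and> J \<subset> K}"
  unfolding wf_iff_no_infinite_down_chain
proof
  assume "\<exists>C. \<forall>i. (C (Suc i), C i)
    \<in> {(K, J). saturated_ideal J \<and> saturated_ideal K \<and> I \<subseteq> J \<and> J \<subset> K}"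
  then obtain C where "\<forall>i. (C (Suc i), C i)
    \<in> {(K, J). saturated_ideal J \<and> saturated_ideal K \<and> I \<subseteq> J \<and> J \<subset> K}" ..
  then have sat: "\<And>i. saturated_ideal (C i)" and I: "\<And>i. I \<subseteq> C i"
    and less: "\<And>i. C i \<subset> C (Suc i)" by simp_all
  have mono: "C i \<subseteq> C j" if "i \<le> j" for i j
    using lift_Suc_mono_le[of C, OF _ that] less by blast
  let ?U = "\<Union>i. C i"
  have ideal_C: "ideal (C i) R" for i
    using sat by (simp add: saturated_ideal_def)
  have "C i \<subseteq> C j \<or> C j \<subseteq> C i" for i j
    using mono nat_le_linear by metis
  with ideal_C have "subset.chain {J. ideal J R} (range C)"
    by (auto simp: subset_chain_def)
  from chain_Union_is_ideal[OF this] have "ideal ?U R" by simp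
  then have "nonnil_ideal R ?U"
    using nonnil_ideal_superset[OF assms(2)] I by blast
  then have "S_finite R S ?U"
    using assms(1) by (auto simp: nonnil_S_Noetherian_def)
  then obtain s A where sA: "s \<in> S" "finite A" "A \<subseteq> ?U"
    "\<forall>J. ideal J R \<and> A \<subseteq> J \<longrightarrow> ?U \<subseteq> colon_ideal J s"
    by (rule S_finiteE)
  from sA(2,3) have "\<exists>n. A \<subseteq> C n"
  proof (induction A)
    case (insert a A)
    then obtain n m where "A \<subseteq> C n" "a \<in> C m" by auto
    then have "insert a A \<subseteq> C (max n m)"
      using mono[of n "max n m"] mono[of m "max n m"] by auto
    then show ?case by blast
  qed auto
  then obtain n where n: "A \<subseteq> C n" by blast
  have "C (Suc n) \<subseteq> C n"
  proof
    fix x assume x: "x \<in> C (Suc n)"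
    then have "s \<otimes> x \<in> C n"
      using sA(4)[rule_format, of "C n"] sat[of n] n
      by (auto simp: saturated_ideal_def colon_ideal_def)
    moreover have "x \<in> carrier R"
      using x by (rule ideal.Icarr[OF ideal_C])
    ultimately show "x \<in> C n"
      using saturated_idealD[OF sat sA(1)] by simp
  qed
  then show False using less[of n] by blast
qed

section \<open>Classical primary decomposition of saturated ideals\<close>

definition primary_disjoint :: "'a set \<Rightarrow> bool" where
  "primary_disjoint Q \<longleftrightarrow> ideal Q R \<and> Q \<inter> S = {} \<and>
     (\<forall>a\<in>carrier R. \<forall>b\<in>carrier R. a \<otimes> b \<in> Q \<longrightarrow> a \<in> Q \<or> b \<in> ideal_radical R Q)"

text \<open>By Noetherian induction: if Q is not primary, it is the intersection of (Q : b^n) and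
  the saturation of Q + b^n R for suitable b and n. Both are proper saturated ideals strictly above
  Q, and the union of their two families decomposes Q.\<close>

lemma saturated_ideal_primary_decomposition:
  assumes noeth: "nonnil_S_Noetherian R S" and I: "nonnil_ideal R I"
    and "saturated_ideal Q" "I \<subseteq> Q" "Q \<noteq> carrier R"
  shows "\<exists>F. finite F \<and> F \<noteq> {} \<and> (\<forall>P\<in>F. primary_disjoint P) \<and> Q = \<Inter>F"
  using assms(3-5)
proof (induction Q rule: wf_induct_rule[OF wf_saturated_ideals[OF noeth I]])
  case (1 Q)
  then interpret Q: ideal Q R by (simp add: saturated_ideal_def)
  show ?case
  proof (cases "primary_disjoint Q")
    case True
    then show ?thesis by (intro exI[of _ "{Q}"]) auto
  next
    case False
    \<comment> \<open>A proper saturated ideal misses S, so only the primary condition can fail for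
      Q.\<close>
    then obtain a b where ab: "a \<in> carrier R" "b \<in> carrier R" "a \<otimes> b \<in> Q" "a \<notin> Q"
      and "b \<notin> ideal_radical R Q"
      using saturated_ideal_Int_empty[OF 1(2,4)] Q.is_ideal
      by (auto simp: primary_disjoint_def)
    then have pow: "b [^] n \<notin> Q" if "0 < n" for n :: nat
      using that ab(2) unfolding ideal_radical_def by blast
    let ?K = "\<lambda>n::nat. colon_ideal Q (b [^] n)"
    have sat_K: "saturated_ideal (?K n)" for n
      using saturated_ideal_colon_ideal[OF 1(2)] ab(2) by simp
    have Q_K: "Q \<subseteq> ?K n" for n
      using colon_ideal_superset[OF Q.is_ideal] ab(2) by simp
    \<comment> \<open>The chain condition supplies a maximal member of the family. The exponent is
      kept positive because both b^n \<notin> Q and a \<in> \<open>?K n\<close> rely on it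
      below.\<close>
    obtain n where n: "0 < n" "\<And>m. 0 < m \<Longrightarrow> \<not> ?K n \<subset> ?K m"
    proof -
      have "?K 1 \<in> ?K ` {0<..}" by (intro image_eqI[where x = 1]) simp_all
      with wf_saturated_ideals[OF noeth I] obtain J where J: "J \<in> ?K ` {0<..}"
        "\<And>L. saturated_ideal J \<and> saturated_ideal L \<and> I \<subseteq> J \<and> J \<subset> L \<Longrightarrow> L \<notin> ?K ` {0<..}"
        by (rule wfE_min) auto
      then obtain n where n: "0 < n" "J = ?K n" by auto
      have I_K: "I \<subseteq> ?K m" for m using Q_K 1(3) by blast
      have "\<not> ?K n \<subset> ?K m" if "0 < m" for m
        using J(2)[of "?K m"] n(2) sat_K I_K that by auto
      with n(1) show thesis by (rule that)
    qed
    have pow_add: "b [^] (n + n) \<otimes> y = b [^] n \<otimes> (b [^] n \<otimes> y)" if "y \<in> carrier R" for y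
      using m_assoc[of "b [^] n" "b [^] n" y] nat_pow_mult[OF ab(2), of n n] that ab(2) by simp
    \<comment> \<open>Stability is compared at exponent n + n because multiplying r b^n by b^n
      produces exactly this exponent.\<close>
    have "?K n \<subseteq> ?K (n + n)"
      using ab(2) Q.I_l_closed by (auto simp: colon_ideal_def pow_add)
    moreover have "\<not> ?K n \<subset> ?K (n + n)"
      using n by simp
    ultimately have stable: "?K (n + n) = ?K n" by blast
    \<comment> \<open>The classical argument takes Q + b^n R itself; here it is saturated so that
      the induction hypothesis applies.\<close>
    let ?B = "Q <+>\<^bsub>R\<^esub> PIdl (b [^] n)"
    let ?M = "saturation ?B"
    have ideal_B: "ideal ?B R"
      using add_ideals[OF Q.is_ideal] cgenideal_ideal ab(2) by simp
    have sat_M: "saturated_ideal ?M"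
      by (rule saturated_ideal_saturation[OF ideal_B])
    have "x \<in> ?B" if "x \<in> Q" for x
      unfolding mem_add_cgenideal_iff
      using that ab(2) by (intro bexI[of _ x] bexI[of _ \<zero>]) auto
    moreover have "b [^] n \<in> ?B"
      unfolding mem_add_cgenideal_iff
      using ab(2) by (intro bexI[of _ \<zero>] bexI[of _ \<one>]) auto
    ultimately have Q_M: "Q \<subset> ?M"
      using saturation_superset[OF ideal_B] pow[OF n(1)] by blast
    have a_K: "a \<in> ?K n"
    proof -
      obtain k where k: "n = Suc k" using n(1) by (cases n) auto
      have "b [^] n \<otimes> a = b [^] k \<otimes> (a \<otimes> b)"
        using ab by (simp add: k m_assoc m_comm[of b a])
      then show ?thesis
        using ab Q.I_l_closed[of "a \<otimes> b" "b [^] k"] by (simp add: colon_ideal_def)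
    qed
    \<comment> \<open>Multiplying s x = q + r b^n by b^n shows b^(2n) r \<in> Q, since b^n x and q
      lie in Q. Stability lowers this to b^n r \<in> Q, so s x \<in> Q, and saturatedness cancels
      s.\<close>
    have "x \<in> Q" if xK: "x \<in> ?K n" and xM: "x \<in> ?M" for x
    proof -
      obtain s q r where s: "s \<in> S" and q: "q \<in> Q" and r: "r \<in> carrier R"
        and sx: "s \<otimes> x = q \<oplus> r \<otimes> b [^] n"
        using xM by (auto simp: saturation_def mem_add_cgenideal_iff)
      have x: "x \<in> carrier R" "b [^] n \<otimes> x \<in> Q"
        using xK by (auto simp: colon_ideal_def)
      have "s \<otimes> (b [^] n \<otimes> x) = b [^] n \<otimes> (s \<otimes> x)"
        using s x ab(2) by (simp add: m_lcomm[of s "b [^] n" x])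
      also have "\<dots> = b [^] n \<otimes> q \<oplus> b [^] (n + n) \<otimes> r"
        using q r ab(2) by (simp add: sx r_distr pow_add m_comm[of r])
      finally have sum: "s \<otimes> (b [^] n \<otimes> x) = b [^] n \<otimes> q \<oplus> b [^] (n + n) \<otimes> r" .
      have sum_Q: "b [^] n \<otimes> q \<oplus> b [^] (n + n) \<otimes> r \<in> Q"
        unfolding sum[symmetric] by (rule Q.I_l_closed[OF x(2)]) (use s in simp)
      have q': "b [^] n \<otimes> q \<in> Q"
        using q ab(2) by (intro Q.I_l_closed) auto
      have "b [^] (n + n) \<otimes> r
          = \<ominus> (b [^] n \<otimes> q) \<oplus> (b [^] n \<otimes> q \<oplus> b [^] (n + n) \<otimes> r)"
        using q r ab(2) by (intro r_neg1[symmetric]) auto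
      also have "\<dots> \<in> Q"
        by (rule Q.a_closed[OF Q.a_inv_closed[OF q'] sum_Q])
      finally have "b [^] (n + n) \<otimes> r \<in> Q" .
      then have "r \<in> ?K (n + n)"
        using r by (simp add: colon_ideal_def)
      then have "r \<in> ?K n" by (simp only: stable)
      then have "s \<otimes> x \<in> Q"
        using r ab(2) q by (simp add: colon_ideal_def sx m_comm[of r])
      then show ?thesis
        by (rule saturated_idealD[OF 1(2) s x(1)])
    qed
    then have eq: "Q = ?K n \<inter> ?M"
      using Q_K Q_M by blast
    have step: "\<exists>F. finite F \<and> F \<noteq> {} \<and> (\<forall>P\<in>F. primary_disjoint P) \<and> L = \<Inter>F"
      if L: "saturated_ideal L" "Q \<subset> L" "L \<noteq> carrier R" for L
    proof (rule 1(1))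
      show "(L, Q) \<in> {(K, J). saturated_ideal J \<and> saturated_ideal K \<and> I \<subseteq> J \<and> J \<subset> K}"
        using 1(2,3) L by simp
    qed (use 1(3) L in blast)+
    have K_proper: "?K n \<noteq> carrier R"
    proof
      assume "?K n = carrier R"
      then have "\<one> \<in> ?K n" by simp
      then show False using pow[OF n(1)] ab(2) by (simp add: colon_ideal_def)
    qed
    have Q_K': "Q \<subset> ?K n" using Q_K[of n] a_K ab(4) by blast
    obtain F where F: "finite F" "F \<noteq> {}" "\<forall>P\<in>F. primary_disjoint P" "?K n = \<Inter>F"
      using step[OF sat_K Q_K' K_proper] by metis
    \<comment> \<open>If \<open>?M\<close> were all of R, the intersection would give Q =
      \<open>?K n\<close>, but a lies in \<open>?K n\<close> and not in Q.\<close>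
    have M_proper: "?M \<noteq> carrier R"
      using eq a_K ab(1,4) by blast
    obtain G where G: "finite G" "G \<noteq> {}" "\<forall>P\<in>G. primary_disjoint P" "?M = \<Inter>G"
      using step[OF sat_M Q_M M_proper] by metis
    have "Q = \<Inter>(F \<union> G)"
      using eq F(4) G(4) by (simp add: Inf_union_distrib)
    then show ?thesis
      using F G by (intro exI[of _ "F \<union> G"]) auto
  qed
qed

section \<open>S-primary ideals and the return from the saturation to I\<close>

lemma S_primary_between:
  assumes Q: "primary_disjoint Q" and Q': "ideal Q' R" "Q' \<subseteq> Q" and u: "u \<in> S"
    and uQ: "\<And>x. x \<in> Q \<Longrightarrow> u \<otimes> x \<in> Q'"
  shows "S_primary R S Q'"
proof -
  interpret Q': ideal Q' R by fact
  have disj: "Q' \<inter> S = {}"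
    using Q Q'(2) by (auto simp: primary_disjoint_def)
  \<comment> \<open>The witness for S-primariness is u. If a \<notin> Q, some b^n with n > 0 lies in
    Q; one factor u of (u b)^n moves b^n into Q', and the other factors stay within the
    ideal.\<close>
  have "u \<otimes> a \<in> Q' \<or> u \<otimes> b \<in> ideal_radical R Q'"
    if ab: "a \<in> carrier R" "b \<in> carrier R" "a \<otimes> b \<in> Q'" for a b
  proof (cases "a \<in> Q")
    case False
    then obtain n :: nat where n: "0 < n" "b [^] n \<in> Q"
      using Q Q'(2) ab unfolding primary_disjoint_def ideal_radical_def by blast
    then obtain k where k: "n = Suc k" by (cases n) auto
    have "(u \<otimes> b) [^] n = u [^] k \<otimes> (u \<otimes> b [^] n)"
      using u ab(2) by (simp add: nat_pow_distrib k m_assoc m_lcomm[of "b [^] k" u b])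
    also have "\<dots> \<in> Q'"
      using uQ[OF n(2)] u by (simp add: Q'.I_l_closed)
    finally show ?thesis
      using n(1) u ab(2) by (auto simp: ideal_radical_def)
  qed (use uQ in blast)
  moreover have "Q' \<noteq> carrier R"
    using disj S.one_closed by auto
  ultimately show ?thesis
    using disj u Q'(1) unfolding S_primary_def by blast
qed

lemma nonnil_ideal_S_decomposable:
  assumes noeth: "nonnil_S_Noetherian R S" and I: "nonnil_ideal R I" and disj: "I \<inter> S = {}"
  shows "S_decomposable R S I"
proof -
  have ideal_I: "ideal I R" using I by (simp add: nonnil_ideal_def)
  interpret I: ideal I R by fact
  have sat: "saturated_ideal (saturation I)"
    by (rule saturated_ideal_saturation[OF ideal_I])
  have sup: "I \<subseteq> saturation I"
    by (rule saturation_superset[OF ideal_I])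
  have "nonnil_ideal R (saturation I)"
    using nonnil_ideal_superset[OF I _ sup] sat by (simp add: saturated_ideal_def)
  then have "S_finite R S (saturation I)"
    using noeth by (simp add: nonnil_S_Noetherian_def)
  with ideal_I obtain u where u: "u \<in> S" "saturation I = colon_ideal I u"
    by (rule saturation_eq_colon_ideal)
  have "\<one> \<notin> saturation I"
    using disj by (auto simp: saturation_def)
  then have "saturation I \<noteq> carrier R" by auto
  then obtain F where F: "finite F" "F \<noteq> {}" "\<forall>Q\<in>F. primary_disjoint Q" "saturation I = \<Inter>F"
    using saturated_ideal_primary_decomposition[OF noeth I sat sup] by blast
  let ?B = "I <+>\<^bsub>R\<^esub> PIdl u"
  have ideal_B: "ideal ?B R"
    using add_ideals[OF ideal_I] cgenideal_ideal u(1) by simp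
  have I_B: "I \<subseteq> ?B"
  proof
    fix x assume "x \<in> I"
    then show "x \<in> ?B"
      unfolding mem_add_cgenideal_iff
      using u(1) by (intro bexI[of _ x] bexI[of _ \<zero>]) auto
  qed
  have u_B: "u \<otimes> x \<in> ?B" if "x \<in> carrier R" for x
    unfolding mem_add_cgenideal_iff
    using that u(1) by (intro bexI[of _ \<zero>] bexI[of _ x]) (auto simp: m_comm)
  \<comment> \<open>For x = i + r u in the saturation, r u = x - i lies there too, and hence so does
    r. As the saturation is (I : u), this yields u r \<in> I.\<close>
  have "x \<in> I" if x: "x \<in> saturation I" "x \<in> ?B" for x
  proof -
    obtain i r where ir: "i \<in> I" "r \<in> carrier R" "x = i \<oplus> r \<otimes> u"
      using x(2) by (auto simp: mem_add_cgenideal_iff)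
    have i: "i \<in> saturation I" using ir(1) sup by blast
    interpret sI: ideal "saturation I" R using sat by (simp add: saturated_ideal_def)
    have "u \<otimes> r = \<ominus> i \<oplus> x"
      using ir u(1) by (simp add: r_neg1 m_comm)
    also have "\<dots> \<in> saturation I"
      using i x(1) by simp
    finally have "r \<in> saturation I"
      by (rule saturated_idealD[OF sat u(1) ir(2)])
    then have "u \<otimes> r \<in> I"
      unfolding u(2) colon_ideal_def by blast
    moreover have "x = i \<oplus> u \<otimes> r"
      using ir(2,3) u(1) by (simp add: m_comm[of r u])
    ultimately show ?thesis
      using I.a_closed[OF ir(1)] by simp
  qed
  then have "I = saturation I \<inter> ?B"
    using sup I_B by blast
  \<comment> \<open>Moving \<open>?B\<close> inside the intersection uses that F is nonempty, since
    the empty intersection is \<open>UNIV\<close>.\<close>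
  also have "\<dots> = \<Inter>((\<lambda>Q. Q \<inter> ?B) ` F)"
    using F(2,4) by auto
  finally have "I = \<Inter>((\<lambda>Q. Q \<inter> ?B) ` F)" .
  moreover have "S_primary R S (Q \<inter> ?B)" if "Q \<in> F" for Q
  proof (rule S_primary_between)
    show Q: "primary_disjoint Q" using F(3) that by blast
    then interpret Q: ideal Q R by (simp add: primary_disjoint_def)
    show "ideal (Q \<inter> ?B) R" by (rule i_intersect[OF Q.is_ideal ideal_B])
    \<comment> \<open>Multiples of u lie in \<open>?B\<close> = I + uR, which gives uQ \<subseteq> Q
      \<inter> \<open>?B\<close>.\<close>
    show "u \<otimes> x \<in> Q \<inter> ?B" if "x \<in> Q" for x
      using that u_B u(1) by (simp add: Q.I_l_closed)
  qed (use u(1) in auto)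
  ultimately show ?thesis
    unfolding S_decomposable_def
    using ideal_I disj F(1,2) by (intro conjI exI[of _ "(\<lambda>Q. Q \<inter> ?B) ` F"]) auto
qed

end

theorem theorem2p22:
  fixes R :: "('a, 'b) ring_scheme" and S :: "'a set"
  assumes "cring R"
    and "submonoid S R"
    and "nonnil_S_Noetherian R S"
  shows "nonnil_S_Laskerian R S"
proof -
  interpret cring_mult_set R S
    using assms(1,2) by (rule cring_mult_set.intro)
  show ?thesis
    using nonnil_ideal_S_decomposable[OF assms(3)] by (simp add: nonnil_S_Laskerian_def)
qed

end
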